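(* Let $\varphi=(1+\sqrt5)/2$ and, for $x>1$ and $\eta>0$, let $$\Delta_{\rm B}(x)=(x^2-1)(x^2+1)^2,\qquad \Delta_{\rm FR}(x)=x^6,\qquad \Delta_{\rm BW}(x;\eta)=\eta^3x^3 .$$ Assume the conditional minimum-log-determinant rule: at fixed $(x,\eta)$ the selected branch is the one with the smallest of these three densities. Then the conditionally selected one-mode branch diagram has two possible topologies, separated by $\eta_c=\sqrt\varphi$. 1. Direct crossover. If $0<\eta<\sqrt\varphi$, the Fisher--Rao branch is never the strict global minimizer. There is a unique point $x_c(\eta)>1$ with $\Delta_{\rm B}(x_c(\eta))=\Delta_{\rm BW}(x_c(\eta);\eta)$, and $1<x_c(\eta)<\sqrt\varphi$. The selected sequence, as $x$ increases, is Bures $\to$ BW (Bures is selected for $1<x<x_c(\eta)$ and BW for $x>x_c(\eta)$). 2. Sequential crossover. If $\eta>\sqrt\varphi$, the Fisher--Rao branch is the strict global minimizer on the nonempty interval $\sqrt\varphi<x<\eta$. The selected sequence, as $x$ increases, is Bures $\to$ Fisher--Rao $\to$ BW, with crossover points $x_{c1}=\sqrt\varphi$ and $x_{c2}=\eta$. At $\eta=\sqrt\varphi$ the intermediate Fisher--Rao interval collapses to zero width, and the three determinant densities coincide at the isolated junction $(x,\eta)=(\sqrt\varphi,\sqrt\varphi)$. Thus this point is the codimension-two boundary between the direct and sequential conditional branch diagrams.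
   Context: $x=2\nu/\hbar$ is the floor-normalized symplectic eigenvalue of the isotropic one-mode covariance $\Sigma=\nu\mathbb 1_2$, and $\eta$ is a constant positive action-matching parameter. $\Delta_{\rm B},\Delta_{\rm FR},\Delta_{\rm BW}$ are the determinants (in a trace-orthonormal basis of the $2\times2$ real symmetric matrices, divided by $8\hbar^6$) of the Gaussian Bures cometric $8\operatorname{Tr}(P\Sigma P\Sigma)+2\hbar^2\operatorname{Tr}(P\Omega P\Omega)$ with $\Omega=\begin{pmatrix}0&1\\-1&0\end{pmatrix}$, the Fisher--Rao cometric $8\operatorname{Tr}(P\Sigma P\Sigma)$, and the scaled Bures--Wasserstein (BW) cometric $4\eta\hbar\operatorname{Tr}(P\Sigma P)$, respectively. A branch ("Bures", "Fisher--Rao", "BW") is the corresponding density; it is the strict global minimizer at $(x,\eta)$ if it is strictly smaller than the other two. *)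

theory Defs
  imports "HOL-Analysis.Analysis"
begin

section \<open>Gaussian cometrics on symmetric 2 x 2 matrices\<close>

definition Omega :: "real^2^2" where
  "Omega = vector [vector [0, 1], vector [-1, 0]]"

definition bures_cometric :: "real \<Rightarrow> real^2^2 \<Rightarrow> real^2^2 \<Rightarrow> real" where
  "bures_cometric hbar \<Sigma> P =
     8 * trace (P ** \<Sigma> ** P ** \<Sigma>) + 2 * hbar\<^sup>2 * trace (P ** Omega ** P ** Omega)"

definition fisher_rao_cometric :: "real^2^2 \<Rightarrow> real^2^2 \<Rightarrow> real" where
  "fisher_rao_cometric \<Sigma> P = 8 * trace (P ** \<Sigma> ** P ** \<Sigma>)"

definition bw_cometric :: "real \<Rightarrow> real \<Rightarrow> real^2^2 \<Rightarrow> real^2^2 \<Rightarrow> real" where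
  "bw_cometric hbar \<eta> \<Sigma> P = 4 * \<eta> * hbar * trace (P ** \<Sigma> ** P)"

text \<open>Three trace-orthonormal elements of the three-dimensional space of symmetric
  matrices automatically form a basis, so spanning is not required separately.\<close>

definition trace_orthonormal_basis :: "(3 \<Rightarrow> real^2^2) \<Rightarrow> bool" where
  "trace_orthonormal_basis E \<longleftrightarrow>
     (\<forall>i. transpose (E i) = E i) \<and>
     (\<forall>i j. trace (E i ** E j) = (if i = j then 1 else 0))"

lemma trace_orthonormal_basis_exists:
  "trace_orthonormal_basis (\<lambda>i.
     if i = 1 then vector [vector [1 / sqrt 2, 0], vector [0, 1 / sqrt 2]]
     else if i = 2 then vector [vector [1 / sqrt 2, 0], vector [0, - (1 / sqrt 2)]]
     else vector [vector [0, 1 / sqrt 2], vector [1 / sqrt 2, 0]])"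
  unfolding trace_orthonormal_basis_def forall_3
  by (simp add: vec_eq_iff forall_2 transpose_def trace_def matrix_matrix_mult_def sum_2 vector_2)

text \<open>The cometrics are given as quadratic forms; the entries of the matrix of such a
  form are the values of its polarization on the basis.\<close>

definition form_det :: "(3 \<Rightarrow> real^2^2) \<Rightarrow> (real^2^2 \<Rightarrow> real) \<Rightarrow> real" where
  "form_det E q =
     det ((\<chi> i j. (q (E i + E j) - q (E i) - q (E j)) / 2) :: real^3^3)"

definition normalized_det :: "real \<Rightarrow> (3 \<Rightarrow> real^2^2) \<Rightarrow> (real^2^2 \<Rightarrow> real) \<Rightarrow> real" where
  "normalized_det hbar E q = form_det E q / (8 * hbar ^ 6)"


section \<open>Determinant densities and the minimum rule\<close>

definition Delta_B :: "real \<Rightarrow> real" where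
  "Delta_B x = (x\<^sup>2 - 1) * (x\<^sup>2 + 1)\<^sup>2"

definition Delta_FR :: "real \<Rightarrow> real" where
  "Delta_FR x = x ^ 6"

definition Delta_BW :: "real \<Rightarrow> real \<Rightarrow> real" where
  "Delta_BW x \<eta> = \<eta> ^ 3 * x ^ 3"

datatype branch = Bures | Fisher_Rao | BW

primrec branch_density :: "branch \<Rightarrow> real \<Rightarrow> real \<Rightarrow> real" where
  "branch_density Bures x \<eta> = Delta_B x"
| "branch_density Fisher_Rao x \<eta> = Delta_FR x"
| "branch_density BW x \<eta> = Delta_BW x \<eta>"

definition strict_global_minimizer :: "branch \<Rightarrow> real \<Rightarrow> real \<Rightarrow> bool" where
  "strict_global_minimizer b x \<eta> \<longleftrightarrow>
     (\<forall>b'. b' \<noteq> b \<longrightarrow> branch_density b x \<eta> < branch_density b' x \<eta>)"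

text \<open>The minimum rule, with ties made explicit: a branch is \<^emph>\<open>the\<close> selected
  branch when this set is a singleton, and crossovers are the points with a tie.\<close>

definition selected :: "real \<Rightarrow> real \<Rightarrow> branch set" where
  "selected x \<eta> = {b. \<forall>b'. branch_density b x \<eta> \<le> branch_density b' x \<eta>}"

text \<open>In \<open>selected_from \<eta> l bs cs\<close> the list \<open>bs\<close> is the sequence of branches selected
  as \<open>x\<close> increases from \<open>l\<close> (exclusive) to infinity, and \<open>cs\<close> lists the
  crossover points, at which exactly the two adjacent branches tie.\<close>

fun selected_from :: "real \<Rightarrow> real \<Rightarrow> branch list \<Rightarrow> real list \<Rightarrow> bool" where
  "selected_from \<eta> l [b] [] \<longleftrightarrow> (\<forall>x>l. selected x \<eta> = {b})"
| "selected_from \<eta> l (b # b' # bs) (c # cs) \<longleftrightarrow>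
     b \<noteq> b' \<and> l < c \<and> (\<forall>x. l < x \<and> x < c \<longrightarrow> selected x \<eta> = {b}) \<and>
     selected c \<eta> = {b, b'} \<and> selected_from \<eta> c (b' # bs) cs"
| "selected_from \<eta> l _ _ \<longleftrightarrow> False"

definition selected_sequence :: "real \<Rightarrow> branch list \<Rightarrow> real list \<Rightarrow> bool" where
  "selected_sequence \<eta> bs cs \<longleftrightarrow> selected_from \<eta> 1 bs cs"

definition direct_diagram :: "real \<Rightarrow> bool" where
  "direct_diagram \<eta> \<longleftrightarrow> (\<exists>c. selected_sequence \<eta> [Bures, BW] [c])"

definition sequential_diagram :: "real \<Rightarrow> bool" where
  "sequential_diagram \<eta> \<longleftrightarrow>
     (\<exists>c\<^sub>1 c\<^sub>2. selected_sequence \<eta> [Bures, Fisher_Rao, BW] [c\<^sub>1, c\<^sub>2])"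

definition parameter_domain :: "(real \<times> real) set" where
  "parameter_domain = {(x, \<eta>). 1 < x \<and> 0 < \<eta>}"

definition crossovers :: "(real \<times> real) set" where
  "crossovers = {(x, \<eta>) \<in> parameter_domain. 2 \<le> card (selected x \<eta>)}"

definition triple_coincidences :: "(real \<times> real) set" where
  "triple_coincidences =
     {(x, \<eta>) \<in> parameter_domain. Delta_B x = Delta_FR x \<and> Delta_FR x = Delta_BW x \<eta>}"

definition golden :: real where
  "golden = (1 + sqrt 5) / 2"

end

theory Submission imports Defs begin

text \<open>On symmetric matrices the three cometrics are of the form
  \<open>\<alpha> Tr(P\<^sup>2) + \<beta> (Tr P)\<^sup>2\<close>; for the Bures one this is Cayley--Hamilton, since
  \<open>Tr(P\<Omega>P\<Omega>) = -2 det P = Tr(P\<^sup>2) - (Tr P)\<^sup>2\<close>.  In a trace-orthonormal basis such a form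
  has the matrix \<open>\<alpha> I + \<beta> t t\<^sup>T\<close>, where \<open>t\<close> is the vector of coordinates of the identity
  and has squared length 2, so its determinant is \<open>\<alpha>\<^sup>2 (\<alpha> + 2 \<beta>)\<close>.

  For the branch diagram, divide all densities by \<open>x\<^sup>3\<close>: they become the strictly increasing
  function \<open>x\<^sup>3 + x - 1/x - 1/x\<^sup>3\<close>, then \<open>x\<^sup>3\<close>, and the constant \<open>\<eta>\<^sup>3\<close>.  The first two
  meet exactly where \<open>x\<^sup>4 = x\<^sup>2 + 1\<close>, that is at the square root of the golden ratio.\<close>

section \<open>Determinants of the cometrics\<close>

lemma symmetric_2_iff:
  "transpose P = P \<longleftrightarrow> P $ 1 $ 2 = P $ 2 $ 1" for P :: "real^2^2"
  by (auto simp: vec_eq_iff forall_2 transpose_def)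

lemma trace_2: "trace P = P $ 1 $ 1 + P $ 2 $ 2" for P :: "real^2^2"
  by (simp add: trace_def sum_2)

lemma matrix_mult_2_nth: "(P ** Q) $ i $ j = P$i$1 * Q$1$j + P$i$2 * Q$2$j"
  for P Q :: "real^2^2"
  by (simp add: sum_2 matrix_matrix_mult_def)

lemma transpose_add: "transpose (A + B) = transpose A + transpose B"
  for A B :: "'a::plus^'n^'m"
  by (simp add: vec_eq_iff transpose_def)

text \<open>Polarization evaluates a form only at basis elements and their pairwise sums, all of
  them symmetric. Identities valid only for symmetric \<open>P\<close>, such as the one for the
  Bures form, can therefore be used inside the determinant.\<close>

lemma form_det_cong:
  assumes "trace_orthonormal_basis E" "\<And>P. transpose P = P \<Longrightarrow> q P = r P"
  shows "form_det E q = form_det E r"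
proof -
  have "q (E i) = r (E i)" "q (E i + E j) = r (E i + E j)" for i j
    using assms unfolding trace_orthonormal_basis_def by (auto simp: transpose_add)
  then show ?thesis
    unfolding form_det_def by simp
qed

text \<open>Parseval for the identity matrix: \<open>trace (E i)\<close> is its coordinate along
  \<open>E i\<close>, and its squared norm is Tr 1 = 2.\<close>

lemma sum_trace_power2_orthonormal_basis:
  assumes "trace_orthonormal_basis E"
  shows "(\<Sum>i\<in>UNIV. (trace (E i))\<^sup>2) = 2"
proof -
  text \<open>The weight \<open>sqrt 2\<close> on the off-diagonal entry makes the coordinate map an isometry.\<close>
  define V :: "real^3^3" where
    "V = (\<chi> i j. if j = 1 then E i $ 1 $ 1 else if j = 2 then sqrt 2 * E i $ 1 $ 2
                 else E i $ 2 $ 2)"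
  have sym: "E i $ 2 $ 1 = E i $ 1 $ 2" for i
    using assms unfolding trace_orthonormal_basis_def symmetric_2_iff by auto
  have V: "V $ i $ 1 = E i $ 1 $ 1" "V $ i $ 2 = sqrt 2 * E i $ 1 $ 2" "V $ i $ 3 = E i $ 2 $ 2" for i
    by (simp_all add: V_def)
  have "V ** transpose V = mat 1"
  proof -
    have "(V ** transpose V) $ i $ j = trace (E i ** E j)" for i j
      by (simp add: matrix_matrix_mult_def transpose_def sum_2 sum_3 V trace_2 sym algebra_simps)
    then show ?thesis
      using assms by (simp add: vec_eq_iff mat_def trace_orthonormal_basis_def)
  qed
  \<comment> \<open>\<open>V\<close> is square because symmetric matrices have three coordinates, so
    orthonormal rows force orthonormal columns.\<close>
  then have *: "transpose V ** V = mat 1"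
    by (simp add: matrix_left_right_inverse)
  have "(transpose V ** V) $ i $ j = (if i = j then 1 else 0)" for i j
    unfolding * by (simp add: mat_def)
  then have "(\<Sum>k\<in>UNIV. V $ k $ i * V $ k $ j) = (if i = j then 1 else 0)" for i j
    by (simp add: matrix_matrix_mult_def transpose_def)
  \<comment> \<open>Columns 1 and 3 hold the diagonal entries. They are orthogonal unit vectors, so
    the squared traces add up to 1 + 1 + 0.\<close>
  from this[of 1 1] this[of 1 3] this[of 3 3] show ?thesis
    by (simp add: V trace_2 sum_3 power2_eq_square algebra_simps)
qed

lemma form_det_trace_form:
  assumes E: "trace_orthonormal_basis E"
    and q: "\<And>P. transpose P = P \<Longrightarrow> q P = \<alpha> * trace (P ** P) + \<beta> * (trace P)\<^sup>2"
  shows "form_det E q = \<alpha>\<^sup>2 * (\<alpha> + 2 * \<beta>)"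
proof -
  define t where "t i = trace (E i)" for i
  let ?r = "\<lambda>P. \<alpha> * trace (P ** P) + \<beta> * (trace P)\<^sup>2"
  \<comment> \<open>Since Tr(PQ) = Tr(QP), the two cross terms of Tr((P + Q)^2) agree and the factor
    1/2 cancels.\<close>
  have "(?r (E i + E j) - ?r (E i) - ?r (E j)) / 2
      = \<alpha> * trace (E i ** E j) + \<beta> * (t i * t j)" for i j
    by (simp add: t_def matrix_mult_2_nth trace_2 power2_eq_square field_simps)
  then have entry: "(?r (E i + E j) - ?r (E i) - ?r (E j)) / 2
      = (if i = j then \<alpha> else 0) + \<beta> * (t i * t j)" for i j
    using E by (simp add: trace_orthonormal_basis_def)
  have "form_det E q = form_det E ?r"
    by (rule form_det_cong[OF E q])
  also have "\<dots> = det ((\<chi> i j. (if i = j then \<alpha> else 0) + \<beta> * (t i * t j)) :: real^3^3)"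
    unfolding form_det_def entry ..
  also have "\<dots> = \<alpha>\<^sup>2 * (\<alpha> + \<beta> * ((t 1)\<^sup>2 + (t 2)\<^sup>2 + (t 3)\<^sup>2))"
    by (simp add: det_3) algebra
  also have "(t 1)\<^sup>2 + (t 2)\<^sup>2 + (t 3)\<^sup>2 = 2"
    using sum_trace_power2_orthonormal_basis[OF E] by (simp add: t_def sum_3)
  finally show ?thesis by (simp add: mult.commute)
qed

section \<open>The cometrics at an isotropic covariance\<close>

lemma mat_2_nth:
  fixes c :: real
  defines "M \<equiv> mat c :: real^2^2"
  shows "M $ 1 $ 1 = c" "M $ 2 $ 2 = c" "M $ 1 $ 2 = 0" "M $ 2 $ 1 = 0"
  by (simp_all add: M_def mat_def)

lemma fisher_rao_cometric_isotropic:
  "fisher_rao_cometric (mat \<nu>) P = 8 * \<nu>\<^sup>2 * trace (P ** P)"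
  unfolding fisher_rao_cometric_def
  by (simp add: trace_2 matrix_mult_2_nth mat_2_nth power2_eq_square algebra_simps)

lemma bw_cometric_isotropic:
  "bw_cometric hbar \<eta> (mat \<nu>) P = 4 * \<eta> * hbar * \<nu> * trace (P ** P)"
  unfolding bw_cometric_def
  by (simp add: trace_2 matrix_mult_2_nth mat_2_nth algebra_simps)

text \<open>Behind the entrywise computation: P Omega P = det(P) Omega for symmetric
  \<open>P\<close>, and Omega^2 = -1.\<close>

lemma trace_Omega_symmetric:
  assumes "transpose P = P"
  shows "trace (P ** Omega ** P ** Omega) = trace (P ** P) - (trace P)\<^sup>2"
  using assms unfolding symmetric_2_iff Omega_def
  by (simp add: trace_2 matrix_mult_2_nth vector_2
      power2_eq_square algebra_simps)

lemma bures_cometric_isotropic: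
  assumes "transpose P = P"
  shows "bures_cometric hbar (mat \<nu>) P
    = (8 * \<nu>\<^sup>2 + 2 * hbar\<^sup>2) * trace (P ** P) + (- 2 * hbar\<^sup>2) * (trace P)\<^sup>2"
  using fisher_rao_cometric_isotropic[of \<nu> P]
  unfolding bures_cometric_def fisher_rao_cometric_def trace_Omega_symmetric[OF assms]
  by (simp add: algebra_simps)

text \<open>With \<nu> = x hbar / 2 the Bures coefficients satisfy \<alpha> = 2 hbar^2 (x^2 + 1) and
  \<alpha> + 2 \<beta> = 2 hbar^2 (x^2 - 1). For the other two forms \<beta> = 0, and \<alpha> is 2
  hbar^2 x^2 or 2 hbar^2 \<eta> x. Each determinant thus carries the factor 8 hbar^6 that the
  normalization removes.\<close>

lemma normalized_det_cometrics:
  assumes "0 < hbar" "x = 2 * \<nu> / hbar" "trace_orthonormal_basis E"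
  shows "normalized_det hbar E (bures_cometric hbar (mat \<nu>)) = Delta_B x"
    and "normalized_det hbar E (fisher_rao_cometric (mat \<nu>)) = Delta_FR x"
    and "normalized_det hbar E (bw_cometric hbar \<eta> (mat \<nu>)) = Delta_BW x \<eta>"
proof -
  have \<nu>: "\<nu> = x * hbar / 2" using assms by simp
  show "normalized_det hbar E (bures_cometric hbar (mat \<nu>)) = Delta_B x"
    using form_det_trace_form[OF assms(3) bures_cometric_isotropic, of hbar \<nu>] assms(1)
    unfolding normalized_det_def \<nu> Delta_B_def
    by (simp add: field_simps eval_nat_numeral)
  show "normalized_det hbar E (fisher_rao_cometric (mat \<nu>)) = Delta_FR x"
    unfolding normalized_det_def
    using form_det_trace_form[OF assms(3), of "fisher_rao_cometric (mat \<nu>)" "8 * \<nu>\<^sup>2" 0] assms(1)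
    unfolding \<nu> Delta_FR_def
    by (simp add: fisher_rao_cometric_isotropic field_simps eval_nat_numeral)
  show "normalized_det hbar E (bw_cometric hbar \<eta> (mat \<nu>)) = Delta_BW x \<eta>"
    unfolding normalized_det_def
    using form_det_trace_form[OF assms(3), of "bw_cometric hbar \<eta> (mat \<nu>)" "4 * \<eta> * hbar * \<nu>" 0]
      assms(1)
    unfolding \<nu> Delta_BW_def
    by (simp add: bw_cometric_isotropic field_simps eval_nat_numeral)
qed


section \<open>The branch diagram\<close>

lemma golden_gt_1: "1 < golden"
proof -
  have "1 < sqrt 5" by (simp add: real_less_rsqrt)
  then show ?thesis by (simp add: golden_def)
qed

lemma sqrt_golden_gt_1: "1 < sqrt golden"
  using golden_gt_1 by simp

lemma golden_square: "golden\<^sup>2 = golden + 1"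
proof -
  have "sqrt 5 * sqrt 5 = (5::real)" by simp
  then show ?thesis unfolding golden_def power2_eq_square by (simp add: field_simps)
qed

section \<open>The rescaled Bures density: monotonicity and comparison with the cube\<close>

definition bures_ratio :: "real \<Rightarrow> real" where
  "bures_ratio x = x ^ 3 + x - 1 / x - 1 / x ^ 3"

lemma Delta_B_eq: "0 < x \<Longrightarrow> Delta_B x = x ^ 3 * bures_ratio x"
  unfolding Delta_B_def bures_ratio_def by (simp add: field_simps eval_nat_numeral)

text \<open>Positive powers of \<open>x\<close> carry the coefficient 1 and negative powers the
  coefficient -1, so each of the four terms increases.\<close>

lemma strict_mono_on_bures_ratio: "strict_mono_on {0<..} bures_ratio"
proof (rule strict_mono_onI)
  fix x y :: real assume "x \<in> {0<..}" "y \<in> {0<..}" "x < y"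
  then have "x ^ 3 < y ^ 3" "1 / y < 1 / x" "1 / y ^ 3 < 1 / x ^ 3"
    by (auto simp: power_strict_mono frac_less2)
  with \<open>x < y\<close> show "bures_ratio x < bures_ratio y"
    unfolding bures_ratio_def by linarith
qed

lemma bures_ratio_less_iff: "0 < x \<Longrightarrow> 0 < y \<Longrightarrow> bures_ratio x < bures_ratio y \<longleftrightarrow> x < y"
  using strict_mono_on_less[OF strict_mono_on_bures_ratio] by simp

lemma bures_ratio_eq_iff: "0 < x \<Longrightarrow> 0 < y \<Longrightarrow> bures_ratio x = bures_ratio y \<longleftrightarrow> x = y"
  using strict_mono_on_eq[OF strict_mono_on_bures_ratio] by simp

lemma continuous_on_bures_ratio: "continuous_on {0<..} bures_ratio"
  unfolding bures_ratio_def by (intro continuous_intros) auto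

text \<open>The difference is (t^2 - t - 1) / x^3 with t = x^2, and the roots of the numerator are
  \<open>golden\<close> and \<open>1 - golden\<close>. The second root is negative, so only the
  first factor can change sign.\<close>

lemma bures_ratio_minus_cube:
  assumes "0 < x"
  shows "bures_ratio x - x ^ 3 = (x\<^sup>2 - golden) * ((x\<^sup>2 + golden - 1) / x ^ 3)"
  using assms golden_square unfolding bures_ratio_def
  by (simp add: field_simps eval_nat_numeral)

lemma bures_ratio_cube_iff:
  assumes "0 < x"
  shows "bures_ratio x < x ^ 3 \<longleftrightarrow> x < sqrt golden"
    and "bures_ratio x = x ^ 3 \<longleftrightarrow> x = sqrt golden"
proof -
  have "0 < x\<^sup>2 + golden - 1"
    using golden_gt_1 zero_le_power2[of x] by linarith
  then have pos: "0 < (x\<^sup>2 + golden - 1) / x ^ 3"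
    using assms by simp
  \<comment> \<open>Both sides of the comparison become square roots. \<open>real_sqrt_abs\<close>
    is switched off below because it would undo this rewriting.\<close>
  have x: "x = sqrt (x\<^sup>2)" using assms by simp
  have "x < sqrt golden \<longleftrightarrow> x\<^sup>2 < golden" "x = sqrt golden \<longleftrightarrow> x\<^sup>2 = golden"
    by (subst x, simp del: real_sqrt_abs)+
  moreover have "bures_ratio x < x ^ 3 \<longleftrightarrow> bures_ratio x - x ^ 3 < 0"
    "bures_ratio x = x ^ 3 \<longleftrightarrow> bures_ratio x - x ^ 3 = 0" by auto
  ultimately show "bures_ratio x < x ^ 3 \<longleftrightarrow> x < sqrt golden"
    "bures_ratio x = x ^ 3 \<longleftrightarrow> x = sqrt golden"
    using pos unfolding bures_ratio_minus_cube[OF assms] mult_less_0_iff mult_eq_0_iff by auto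
qed

lemma bures_ratio_sqrt_golden: "bures_ratio (sqrt golden) = sqrt golden ^ 3"
  using bures_ratio_cube_iff(2)[of "sqrt golden"] golden_gt_1 by simp

lemma cube_less_iff: "0 < x \<Longrightarrow> 0 < y \<Longrightarrow> x ^ 3 < y ^ 3 \<longleftrightarrow> x < y" for x y :: real
  by (meson less_imp_le not_less power_mono power_strict_mono zero_less_numeral)

lemma cube_eq_iff: "0 < x \<Longrightarrow> 0 < y \<Longrightarrow> x ^ 3 = y ^ 3 \<longleftrightarrow> x = y" for x y :: real
  by (simp add: power_eq_iff_eq_base)

lemma Delta_FR_eq: "Delta_FR x = x ^ 3 * x ^ 3"
  by (simp add: Delta_FR_def flip: power_add)

section \<open>Selection as a comparison of the rescaled densities\<close>

primrec branch_ratio :: "branch \<Rightarrow> real \<Rightarrow> real \<Rightarrow> real" where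
  "branch_ratio Bures x \<eta> = bures_ratio x"
| "branch_ratio Fisher_Rao x \<eta> = x ^ 3"
| "branch_ratio BW x \<eta> = \<eta> ^ 3"

lemma branch_density_eq: "0 < x \<Longrightarrow> branch_density b x \<eta> = x ^ 3 * branch_ratio b x \<eta>"
  by (cases b) (simp_all add: Delta_B_eq Delta_FR_eq Delta_BW_def)

lemma all_branch: "(\<forall>b. Q b) \<longleftrightarrow> Q Bures \<and> Q Fisher_Rao \<and> Q BW"
  by (metis branch.exhaust)

lemma selected_eq:
  assumes "0 < x"
  shows "selected x \<eta> = {b. \<forall>b'. branch_ratio b x \<eta> \<le> branch_ratio b' x \<eta>}"
  unfolding selected_def using assms by (simp add: branch_density_eq)

lemma in_selected_iff:
  assumes "0 < x"
  shows "Bures \<in> selected x \<eta> \<longleftrightarrow> bures_ratio x \<le> x ^ 3 \<and> bures_ratio x \<le> \<eta> ^ 3"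
    and "Fisher_Rao \<in> selected x \<eta> \<longleftrightarrow> x ^ 3 \<le> bures_ratio x \<and> x ^ 3 \<le> \<eta> ^ 3"
    and "BW \<in> selected x \<eta> \<longleftrightarrow> \<eta> ^ 3 \<le> bures_ratio x \<and> \<eta> ^ 3 \<le> x ^ 3"
  unfolding selected_eq[OF assms] by (simp_all add: all_branch)

text \<open>Each competitor supplies one endpoint: Bures the left one, BW the right one.\<close>

lemma Fisher_Rao_in_selected_iff:
  assumes "0 < x" "0 < \<eta>"
  shows "Fisher_Rao \<in> selected x \<eta> \<longleftrightarrow> sqrt golden \<le> x \<and> x \<le> \<eta>"
  using in_selected_iff(2)[OF assms(1)] bures_ratio_cube_iff(1)[OF assms(1)]
    cube_less_iff[OF assms(2,1)] by (simp add: not_less[symmetric])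

lemma strict_global_minimizer_Fisher_Rao_iff:
  assumes "0 < x" "0 < \<eta>"
  shows "strict_global_minimizer Fisher_Rao x \<eta> \<longleftrightarrow> sqrt golden < x \<and> x < \<eta>"
proof -
  have "strict_global_minimizer Fisher_Rao x \<eta> \<longleftrightarrow> x ^ 3 < bures_ratio x \<and> x ^ 3 < \<eta> ^ 3"
    unfolding strict_global_minimizer_def branch_density_eq[OF assms(1)]
      mult_less_cancel_left_pos[OF zero_less_power[OF assms(1)]] all_branch
    by simp
  also have "\<dots> \<longleftrightarrow> sqrt golden < x \<and> x < \<eta>"
    using bures_ratio_cube_iff[OF assms(1)] cube_less_iff[OF assms] by force
  finally show ?thesis .
qed

text \<open>The bound \<open>1 < x\<close> is absorbed by \<open>1 < sqrt golden\<close>. For \<eta>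
  at the threshold the same identity yields the empty set.\<close>

lemma Fisher_Rao_strict_region:
  assumes "0 < \<eta>"
  shows "{x. 1 < x \<and> strict_global_minimizer Fisher_Rao x \<eta>} = {sqrt golden<..<\<eta>}"
proof -
  have "1 < x \<and> strict_global_minimizer Fisher_Rao x \<eta> \<longleftrightarrow> sqrt golden < x \<and> x < \<eta>" for x
    using strict_global_minimizer_Fisher_Rao_iff[of x \<eta>] assms
    by (cases "1 < x") (auto dest: less_trans[OF sqrt_golden_gt_1])
  then show ?thesis by (simp add: set_eq_iff)
qed

text \<open>Splits a claim about a selected set into three membership claims, which
  \<open>in_selected_iff\<close> turns into inequalities.\<close>

lemma branch_set_eq_iff:
  "A = B \<longleftrightarrow> (Bures \<in> A \<longleftrightarrow> Bures \<in> B) \<and> (Fisher_Rao \<in> A \<longleftrightarrow> Fisher_Rao \<in> B) \<and> (BW \<in> A \<longleftrightarrow> BW \<in> B)"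
  by (auto simp: set_eq_iff all_branch)

section \<open>Selected sequences below and above the threshold\<close>

lemma Delta_B_eq_Delta_BW_iff: "0 < x \<Longrightarrow> Delta_B x = Delta_BW x \<eta> \<longleftrightarrow> bures_ratio x = \<eta> ^ 3"
  by (simp add: Delta_B_eq Delta_BW_def)

text \<open>Intermediate value theorem between 1, where \<open>bures_ratio\<close> vanishes, and
  \<open>sqrt golden\<close>, where it equals the cube.\<close>

lemma direct_crossing_exists:
  assumes "0 < \<eta>" "\<eta> < sqrt golden"
  shows "\<exists>x>1. bures_ratio x = \<eta> ^ 3"
proof -
  have "bures_ratio 1 \<le> \<eta> ^ 3" "\<eta> ^ 3 \<le> bures_ratio (sqrt golden)"
    using assms by (auto simp: bures_ratio_def[of 1] bures_ratio_sqrt_golden intro: power_mono)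
  moreover have "continuous_on {1..sqrt golden} bures_ratio"
    by (rule continuous_on_subset[OF continuous_on_bures_ratio]) auto
  ultimately obtain x where "1 \<le> x" "bures_ratio x = \<eta> ^ 3"
    using IVT'[of bures_ratio 1 "\<eta> ^ 3" "sqrt golden"] sqrt_golden_gt_1 by auto
  moreover have "x \<noteq> 1"
    using \<open>bures_ratio x = \<eta> ^ 3\<close> assms(1) by (auto simp: bures_ratio_def)
  ultimately show ?thesis by force
qed

lemma direct_selected_sequence:
  assumes "0 < \<eta>" "\<eta> < sqrt golden" "1 < c" "bures_ratio c = \<eta> ^ 3"
  shows "c < sqrt golden" "selected_sequence \<eta> [Bures, BW] [c]"
proof -
  have "bures_ratio c < bures_ratio (sqrt golden)"
    unfolding bures_ratio_sqrt_golden assms(4)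
    using assms(1,2) by (intro power_strict_mono) auto
  then show c: "c < sqrt golden"
    using bures_ratio_less_iff[of c "sqrt golden"] assms(3) golden_gt_1 by simp
  \<comment> \<open>The key point: where BW meets Bures it already lies below Fisher-Rao. It stays
    below as \<open>x\<close> grows, so Fisher-Rao never gets a turn.\<close>
  have "\<eta> ^ 3 < c ^ 3"
    using bures_ratio_cube_iff(1)[of c] c assms(3,4) by simp
  moreover have "selected x \<eta> = {Bures}" if "1 < x" "x < c" for x
  proof -
    have "bures_ratio x < x ^ 3" "bures_ratio x < \<eta> ^ 3"
      using bures_ratio_cube_iff(1)[of x] bures_ratio_less_iff[of x c] that c assms(4) by auto
    with that show ?thesis by (subst branch_set_eq_iff) (simp add: in_selected_iff)
  qed
  moreover have "selected x \<eta> = {BW}" if "c < x" for x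
  proof -
    have "c ^ 3 < x ^ 3"
      using that assms(3) by (simp add: cube_less_iff)
    moreover have "\<eta> ^ 3 < bures_ratio x"
      using bures_ratio_less_iff[of c x] that assms(3,4) by auto
    ultimately show ?thesis
      using that assms(3) \<open>\<eta> ^ 3 < c ^ 3\<close> by (subst branch_set_eq_iff) (simp add: in_selected_iff)
  qed
  moreover have "selected c \<eta> = {Bures, BW}"
    using \<open>\<eta> ^ 3 < c ^ 3\<close> assms(3,4) by (subst branch_set_eq_iff) (simp add: in_selected_iff)
  ultimately show "selected_sequence \<eta> [Bures, BW] [c]"
    using assms(3) by (simp add: selected_sequence_def)
qed

lemma sequential_selected_sequence:
  assumes "sqrt golden < \<eta>"
  shows "selected_sequence \<eta> [Bures, Fisher_Rao, BW] [sqrt golden, \<eta>]"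
proof -
  have \<eta>: "0 < \<eta>" "1 < \<eta>" using assms sqrt_golden_gt_1 by linarith+
  \<comment> \<open>The position of \<open>x\<close> relative to \<open>sqrt golden\<close> and
    \<eta> decides the comparisons with the cube. The remaining one, Bures against BW, follows by
    transitivity through the cube.\<close>
  have *: "bures_ratio x < x ^ 3 \<longleftrightarrow> x < sqrt golden" "bures_ratio x = x ^ 3 \<longleftrightarrow> x = sqrt golden"
    "x ^ 3 < \<eta> ^ 3 \<longleftrightarrow> x < \<eta>" "x ^ 3 = \<eta> ^ 3 \<longleftrightarrow> x = \<eta>" if "1 < x" for x
    using that \<eta> bures_ratio_cube_iff[of x] by (simp_all add: cube_less_iff cube_eq_iff)
  have "selected x \<eta> = {Bures}" if "1 < x" "x < sqrt golden" for x
    using *[of x] that assms by (subst branch_set_eq_iff) (simp add: in_selected_iff)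
  moreover have "selected (sqrt golden) \<eta> = {Bures, Fisher_Rao}"
    using *[of "sqrt golden"] sqrt_golden_gt_1 assms
    by (subst branch_set_eq_iff) (simp add: in_selected_iff)
  moreover have "selected x \<eta> = {Fisher_Rao}" if "sqrt golden < x" "x < \<eta>" for x
  proof -
    have "1 < x" using that sqrt_golden_gt_1 by linarith
    with *[OF this] that show ?thesis
      by (subst branch_set_eq_iff) (simp add: in_selected_iff)
  qed
  moreover have "selected \<eta> \<eta> = {Fisher_Rao, BW}"
    using *[OF \<eta>(2)] \<eta> assms by (subst branch_set_eq_iff) (simp add: in_selected_iff)
  moreover have "selected x \<eta> = {BW}" if "\<eta> < x" for x
  proof -
    have "1 < x" using that \<eta> by linarith
    with *[OF this] that assms show ?thesis
      by (subst branch_set_eq_iff) (auto simp: in_selected_iff)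
  qed
  ultimately show ?thesis
    using assms sqrt_golden_gt_1 by (simp add: selected_sequence_def)
qed

section \<open>Which parameters give which diagram\<close>

lemma direct_diagramD:
  assumes "direct_diagram \<eta>" "1 < x"
  shows "selected x \<eta> \<noteq> {Fisher_Rao}" "selected x \<eta> \<noteq> UNIV"
proof -
  obtain c where c: "selected_sequence \<eta> [Bures, BW] [c]"
    using assms(1) unfolding direct_diagram_def by blast
  then have "selected x \<eta> \<subseteq> {Bures, BW}"
    using assms(2) by (cases x c rule: linorder_cases) (simp_all add: selected_sequence_def)
  then show "selected x \<eta> \<noteq> {Fisher_Rao}" "selected x \<eta> \<noteq> UNIV" by auto
qed

text \<open>The witnesses are the two crossover points, at both of which Fisher-Rao ties. Their
  distinctness is what excludes the threshold value of \<eta>.\<close>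

lemma sequential_diagramD:
  assumes "sequential_diagram \<eta>"
  shows "\<exists>x y. 1 < x \<and> x < y \<and> Fisher_Rao \<in> selected x \<eta> \<and> Fisher_Rao \<in> selected y \<eta>"
proof -
  obtain c d where cd: "selected_sequence \<eta> [Bures, Fisher_Rao, BW] [c, d]"
    using assms unfolding sequential_diagram_def by blast
  then show ?thesis
    by (intro exI[of _ c] exI[of _ d]) (simp add: selected_sequence_def)
qed

lemma selected_junction: "selected (sqrt golden) (sqrt golden) = UNIV"
  using golden_gt_1 by (subst branch_set_eq_iff) (simp add: in_selected_iff bures_ratio_sqrt_golden)

text \<open>The crossover point in a direct diagram is arbitrary, so the converse uses what no
  choice of it permits: a triple tie, which occurs at the threshold, or Fisher-Rao as sole selected
  branch, which occurs above it.\<close>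

lemma direct_diagram_iff:
  assumes "0 < \<eta>"
  shows "direct_diagram \<eta> \<longleftrightarrow> \<eta> < sqrt golden"
proof
  assume "\<eta> < sqrt golden"
  then show "direct_diagram \<eta>"
    using direct_crossing_exists[OF assms] direct_selected_sequence(2)[OF assms]
    unfolding direct_diagram_def by blast
next
  assume d: "direct_diagram \<eta>"
  show "\<eta> < sqrt golden"
  proof (rule ccontr)
    assume "\<not> \<eta> < sqrt golden"
    then consider "\<eta> = sqrt golden" | "sqrt golden < \<eta>" by linarith
    then show False
    proof cases
      case 1
      then show False
        using direct_diagramD(2)[OF d sqrt_golden_gt_1] selected_junction by simp
    next
      case 2
      then obtain x where x: "sqrt golden < x" "x < \<eta>" using dense by blast
      then have "selected x \<eta> = {Fisher_Rao}"
        using sequential_selected_sequence[OF 2] by (simp add: selected_sequence_def)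
      then show False
        using direct_diagramD(1)[OF d, of x] x sqrt_golden_gt_1 by simp
    qed
  qed
qed

lemma sequential_diagram_iff:
  assumes "0 < \<eta>"
  shows "sequential_diagram \<eta> \<longleftrightarrow> sqrt golden < \<eta>"
proof
  assume "sequential_diagram \<eta>"
  then obtain x y where "1 < x" "x < y" "Fisher_Rao \<in> selected x \<eta>" "Fisher_Rao \<in> selected y \<eta>"
    using sequential_diagramD by blast
  \<comment> \<open>The chain is \<open>sqrt golden \<le> x < y \<le> \<eta>\<close>.\<close>
  then show "sqrt golden < \<eta>"
    using Fisher_Rao_in_selected_iff[of x \<eta>] Fisher_Rao_in_selected_iff[of y \<eta>] assms by simp
next
  assume "sqrt golden < \<eta>"
  then show "sequential_diagram \<eta>"
    unfolding sequential_diagram_def using sequential_selected_sequence by blast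
qed

section \<open>The junction and the crossover curves that meet there\<close>

lemma triple_coincidences_eq: "triple_coincidences = {(sqrt golden, sqrt golden)}"
proof -
  have "(1 < x \<and> 0 < \<eta> \<and> Delta_B x = Delta_FR x \<and> Delta_FR x = Delta_BW x \<eta>)
      \<longleftrightarrow> x = sqrt golden \<and> \<eta> = sqrt golden" for x \<eta>
  proof (cases "1 < x \<and> 0 < \<eta>")
    case True
    then have "0 < x" "x ^ 3 \<noteq> 0" by auto
    then have "Delta_B x = Delta_FR x \<longleftrightarrow> bures_ratio x = x ^ 3"
      "Delta_FR x = Delta_BW x \<eta> \<longleftrightarrow> x ^ 3 = \<eta> ^ 3"
      unfolding Delta_B_eq[OF \<open>0 < x\<close>] Delta_BW_def Delta_FR_eq mult.commute[of "\<eta> ^ 3"]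
        mult_left_cancel[OF \<open>x ^ 3 \<noteq> 0\<close>] by simp_all
    with True show ?thesis
      using bures_ratio_cube_iff(2)[of x] cube_eq_iff[of x \<eta>] by auto
  next
    case False
    then show ?thesis using golden_gt_1 by auto
  qed
  then show ?thesis
    unfolding triple_coincidences_def parameter_domain_def by auto
qed

lemma junction_in_closure_direct:
  "(sqrt golden, sqrt golden) \<in> closure {(x, \<eta>) \<in> crossovers. direct_diagram \<eta>}"
proof -
  text \<open>The direct crossover curve is the graph of this function of \<open>x\<close>.\<close>
  define h where "h x = root 3 (bures_ratio x)" for x
  have curve: "(x, h x) \<in> {(x, \<eta>) \<in> crossovers. direct_diagram \<eta>}"
    if "1 < x" "x < sqrt golden" for x
  proof -
    have pos: "0 < bures_ratio x"
      using bures_ratio_less_iff[of 1 x] that by (simp add: bures_ratio_def[of 1])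
    then have h: "0 < h x" "bures_ratio x = h x ^ 3"
      by (simp_all add: h_def)
    have "h x ^ 3 < sqrt golden ^ 3"
      using bures_ratio_less_iff[of x "sqrt golden"] that golden_gt_1 h
      by (simp add: bures_ratio_sqrt_golden)
    then have less: "h x < sqrt golden"
      using cube_less_iff[of "h x" "sqrt golden"] h golden_gt_1 by simp
    \<comment> \<open>For the parameter \<open>h x\<close>, the point \<open>x\<close> itself is the
      direct crossover.\<close>
    have "selected x (h x) = {Bures, BW}"
      using direct_selected_sequence(2)[OF h(1) less that(1) h(2)]
      by (simp add: selected_sequence_def)
    with that h less show ?thesis
      by (simp add: crossovers_def parameter_domain_def direct_diagram_iff)
  qed
  have "continuous_on {0<..} h"
    unfolding h_def by (intro continuous_intros continuous_on_bures_ratio)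
  then have "isCont h (sqrt golden)"
    by (rule continuous_on_interior) (use golden_gt_1 in \<open>simp add: interior_open\<close>)
  moreover have "h (sqrt golden) = sqrt golden"
    using golden_gt_1 by (simp add: h_def bures_ratio_sqrt_golden real_root_power_cancel)
  \<comment> \<open>The limit is taken from the left, since the curve has been placed in the direct
    region only for \<open>x < sqrt golden\<close>.\<close>
  ultimately have "((\<lambda>x. (x, h x)) \<longlongrightarrow> (sqrt golden, sqrt golden)) (at_left (sqrt golden))"
    by (intro tendsto_intros) (auto simp: isCont_def intro: tendsto_within_subset)
  moreover have "eventually (\<lambda>x. (x, h x) \<in> closure {(x, \<eta>) \<in> crossovers. direct_diagram \<eta>})
      (at_left (sqrt golden))"
    using eventually_at_left_real[OF sqrt_golden_gt_1]
    by eventually_elim (use curve closure_subset in fastforce)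
  ultimately show ?thesis
    by (intro Lim_in_closed_set[OF closed_closure]) (auto simp: trivial_limit_at_left_real)
qed

text \<open>The sequential crossovers form two open rays leaving the junction, one along
  \<open>x = sqrt golden\<close> and one along the diagonal. Trichotomy against both values leaves
  selected sets of known size 1 or 2.\<close>

lemma sequential_crossovers_eq:
  "{(x, \<eta>) \<in> crossovers. sequential_diagram \<eta>}
    = {(x, \<eta>). sqrt golden < \<eta> \<and> (x = sqrt golden \<or> x = \<eta>)}"
proof -
  have "1 < x \<and> 0 < \<eta> \<and> 2 \<le> card (selected x \<eta>) \<and> sequential_diagram \<eta>
    \<longleftrightarrow> sqrt golden < \<eta> \<and> (x = sqrt golden \<or> x = \<eta>)" for x \<eta>
  proof (cases "sqrt golden < \<eta>")
    case True
    have "0 < \<eta>" "1 < \<eta>" using True sqrt_golden_gt_1 by linarith+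
    moreover have "2 \<le> card (selected x \<eta>) \<longleftrightarrow> x = sqrt golden \<or> x = \<eta>" if "1 < x"
      using sequential_selected_sequence[OF True] that
      by (cases x "sqrt golden" rule: linorder_cases; cases x \<eta> rule: linorder_cases)
        (simp_all add: selected_sequence_def)
    ultimately show ?thesis
      using True sqrt_golden_gt_1 sequential_diagram_iff[of \<eta>] by metis
  next
    case False
    then show ?thesis by (auto simp: sequential_diagram_iff)
  qed
  then show ?thesis
    unfolding crossovers_def parameter_domain_def by auto
qed

lemma junction_in_closure_sequential:
  "(sqrt golden, sqrt golden) \<in> closure {(x, \<eta>) \<in> crossovers. sequential_diagram \<eta>}"
proof -
  \<comment> \<open>The junction is approached along the diagonal ray, the Fisher-Rao to BW
    crossover.\<close>
  have "((\<lambda>y. (y, y)) \<longlongrightarrow> (sqrt golden, sqrt golden)) (at_right (sqrt golden))"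
    by (intro tendsto_intros)
  moreover have "eventually (\<lambda>y. (y, y) \<in> closure {(x, \<eta>) \<in> crossovers. sequential_diagram \<eta>})
      (at_right (sqrt golden))"
    unfolding sequential_crossovers_eq
    using eventually_at_right_less[of "sqrt golden"]
    by eventually_elim (use closure_subset in fastforce)
  ultimately show ?thesis
    by (intro Lim_in_closed_set[OF closed_closure]) (auto simp: trivial_limit_at_right_real)
qed

text \<open>Makes precise that the junction separates the two diagrams. The direct side bounds
  \<eta> from above and the sequential side from below, so \<eta> = \<open>sqrt golden\<close>;
  either closed ray then forces the same value of \<open>x\<close>.\<close>

lemma closure_crossovers_Int:
  "closure {(x, \<eta>) \<in> crossovers. direct_diagram \<eta>} \<inter>
    closure {(x, \<eta>) \<in> crossovers. sequential_diagram \<eta>} = {(sqrt golden, sqrt golden)}"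
proof -
  have "closure {(x, \<eta>) \<in> crossovers. direct_diagram \<eta>} \<subseteq> {p. snd p \<le> sqrt golden}"
    by (intro closure_minimal closed_Collect_le continuous_intros)
      (auto simp: crossovers_def parameter_domain_def direct_diagram_iff)
  moreover have "closure {(x, \<eta>) \<in> crossovers. sequential_diagram \<eta>}
      \<subseteq> {p. sqrt golden \<le> snd p \<and> (fst p = sqrt golden \<or> fst p = snd p)}"
    unfolding sequential_crossovers_eq
    by (intro closure_minimal closed_Collect_conj closed_Collect_disj closed_Collect_le
        closed_Collect_eq continuous_intros) auto
  ultimately show ?thesis
    using junction_in_closure_direct junction_in_closure_sequential by fastforce
qed

text \<open>A nonempty open set has the full dimension of the plane. Against the dimension 0 of a
  single point this gives codimension two.\<close>

lemma aff_dim_parameter_domain: "aff_dim parameter_domain = 2"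
proof -
  have eq: "parameter_domain = {1<..} \<times> {0<..}"
    by (auto simp: parameter_domain_def)
  have "(2, 1) \<in> parameter_domain" by (simp add: eq)
  then have "aff_dim parameter_domain = DIM(real \<times> real)"
    by (intro aff_dim_open) (auto simp: eq intro: open_Times)
  then show ?thesis by simp
qed

theorem proposition18:
  shows
    "(\<forall>hbar \<nu> \<eta> x E. 0 < hbar \<and> 0 < \<eta> \<and> x = 2 * \<nu> / hbar \<and> 1 < x \<and> trace_orthonormal_basis E \<longrightarrow>
        normalized_det hbar E (bures_cometric hbar (mat \<nu>)) = Delta_B x \<and>
        normalized_det hbar E (fisher_rao_cometric (mat \<nu>)) = Delta_FR x \<and>
        normalized_det hbar E (bw_cometric hbar \<eta> (mat \<nu>)) = Delta_BW x \<eta>) \<and>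
     (\<forall>\<eta>>0. (direct_diagram \<eta> \<longleftrightarrow> \<eta> < sqrt golden) \<and>
             (sequential_diagram \<eta> \<longleftrightarrow> sqrt golden < \<eta>)) \<and>
     (\<forall>\<eta>. 0 < \<eta> \<and> \<eta> < sqrt golden \<longrightarrow>
        (\<forall>x>1. \<not> strict_global_minimizer Fisher_Rao x \<eta>) \<and>
        (\<exists>!x\<^sub>c. 1 < x\<^sub>c \<and> Delta_B x\<^sub>c = Delta_BW x\<^sub>c \<eta>) \<and>
        (\<forall>x\<^sub>c. 1 < x\<^sub>c \<and> Delta_B x\<^sub>c = Delta_BW x\<^sub>c \<eta> \<longrightarrow>
           x\<^sub>c < sqrt golden \<and> selected_sequence \<eta> [Bures, BW] [x\<^sub>c])) \<and>
     (\<forall>\<eta>. sqrt golden < \<eta> \<longrightarrow>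
        {sqrt golden<..<\<eta>} \<noteq> {} \<and>
        {x. 1 < x \<and> strict_global_minimizer Fisher_Rao x \<eta>} = {sqrt golden<..<\<eta>} \<and>
        selected_sequence \<eta> [Bures, Fisher_Rao, BW] [sqrt golden, \<eta>]) \<and>
     {x. 1 < x \<and> strict_global_minimizer Fisher_Rao x (sqrt golden)} = {} \<and>
     {x. 1 < x \<and> Fisher_Rao \<in> selected x (sqrt golden)} = {sqrt golden} \<and>
     triple_coincidences = {(sqrt golden, sqrt golden)} \<and>
     closure {(x, \<eta>) \<in> crossovers. direct_diagram \<eta>} \<inter>
       closure {(x, \<eta>) \<in> crossovers. sequential_diagram \<eta>} = {(sqrt golden, sqrt golden)} \<and>
     aff_dim parameter_domain - aff_dim triple_coincidences = 2"
proof (intro conjI allI impI)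
  fix \<eta> :: real assume "0 < \<eta> \<and> \<eta> < sqrt golden"
  then have \<eta>: "0 < \<eta>" "\<eta> < sqrt golden" by auto
  show "\<not> strict_global_minimizer Fisher_Rao x \<eta>" if "1 < x" for x
    using strict_global_minimizer_Fisher_Rao_iff[of x \<eta>] that \<eta> by simp
  show "\<exists>!x\<^sub>c. 1 < x\<^sub>c \<and> Delta_B x\<^sub>c = Delta_BW x\<^sub>c \<eta>"
  proof (rule ex_ex1I)
    show "\<exists>x. 1 < x \<and> Delta_B x = Delta_BW x \<eta>"
      using direct_crossing_exists[OF \<eta>] by (auto simp: Delta_B_eq_Delta_BW_iff)
    \<comment> \<open>Uniqueness is injectivity of \<open>bures_ratio\<close>, because the BW level
      \<eta>^3 does not depend on \<open>x\<close>.\<close>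
    show "x = y" if "1 < x \<and> Delta_B x = Delta_BW x \<eta>" "1 < y \<and> Delta_B y = Delta_BW y \<eta>" for x y
      using that bures_ratio_eq_iff[of x y] by (auto simp: Delta_B_eq_Delta_BW_iff)
  qed
  show "x\<^sub>c < sqrt golden" "selected_sequence \<eta> [Bures, BW] [x\<^sub>c]"
    if "1 < x\<^sub>c \<and> Delta_B x\<^sub>c = Delta_BW x\<^sub>c \<eta>" for x\<^sub>c
    using direct_selected_sequence[OF \<eta>, of x\<^sub>c] that by (auto simp: Delta_B_eq_Delta_BW_iff)
next
  fix \<eta> :: real assume \<eta>: "sqrt golden < \<eta>"
  show "{sqrt golden<..<\<eta>} \<noteq> {}" using \<eta> by simp
  show "selected_sequence \<eta> [Bures, Fisher_Rao, BW] [sqrt golden, \<eta>]"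
    by (rule sequential_selected_sequence[OF \<eta>])
  have "0 < \<eta>" using \<eta> sqrt_golden_gt_1 by linarith
  then show "{x. 1 < x \<and> strict_global_minimizer Fisher_Rao x \<eta>} = {sqrt golden<..<\<eta>}"
    by (rule Fisher_Rao_strict_region)
next
  have pos: "0 < sqrt golden" using golden_gt_1 by simp
  show "{x. 1 < x \<and> strict_global_minimizer Fisher_Rao x (sqrt golden)} = {}"
    using Fisher_Rao_strict_region[OF pos] by simp
  \<comment> \<open>The two endpoints of the closed Fisher-Rao range coincide here, which is the
    collapse to zero width.\<close>
  show "{x. 1 < x \<and> Fisher_Rao \<in> selected x (sqrt golden)} = {sqrt golden}"
    using Fisher_Rao_in_selected_iff[OF _ pos] sqrt_golden_gt_1 by fastforce
next
  show "aff_dim parameter_domain - aff_dim triple_coincidences = 2"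
    by (simp add: aff_dim_parameter_domain triple_coincidences_eq)
qed (auto intro: normalized_det_cometrics
    simp: direct_diagram_iff sequential_diagram_iff triple_coincidences_eq closure_crossovers_Int)

end
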